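(* The set function $\mu$ defined on the Borel $\sigma$-field $\mathfrak{C}$ of $\mathbf{C}$ by $\mu(A)=\sup\{\varphi(K): K\subset A,\ K \text{ compact}\}$, $A\in\mathfrak{C}$, is a probability measure.
   Context: $\mathbf{C}=\mathbf{C}[0,1]$ is the space of real-valued continuous functions on $[0,1]$ vanishing at $0$, with the norm $\|x\|=\sup_{0\le t\le 1}|x(t)|$; $\mathfrak{C}$ is its Borel $\sigma$-field. For $t_1,\dots,t_k\in(0,1]$, $\pi_{t_1,\dots,t_k}:\mathbf{C}\to\mathbb{R}^k$ is $\pi_{t_1,\dots,t_k}(x)=(x(t_1),\dots,x(t_k))$, and $\mathfrak{R}^k$ is the Borel $\sigma$-field of $\mathbb{R}^k$. $\nu_{t_1,\dots,t_k}$ is the $k$-variate normal distribution on $\mathfrak{R}^k$ with zero means and covariance $\min\{t_j,t_r\}$ between the $j$-th and $r$-th components. $\alpha_{t_1,\dots,t_k}$ is the measure on the sub-$\sigma$-field $\pi_{t_1,\dots,t_k}^{-1}(\mathfrak{R}^k)$ given by $\alpha_{t_1,\dots,t_k}(\pi_{t_1,\dots,t_k}^{-1}(B))=\nu_{t_1,\dots,t_k}(B)$, $B\in\mathfrak{R}^k$. Fix a countable dense subset $T=\{t_1,t_2,\dots\}$ of $[0,1]$ consisting of distinct points of $(0,1]$. For compact $K\subset\mathbf{C}$ define $\varphi(K)=\lim_{n\to\infty}\alpha_{t_1,\dots,t_n}\big(\pi_{t_1,\dots,t_n}^{-1}\pi_{t_1,\dots,t_n}(K)\big)$ (the limit of a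 non-increasing sequence of nonnegative numbers). One also sets $\varphi(\mathbf{C})=1$; the supremum defining $\mu$ runs over compact sets only. *)

theory Defs
  imports "HOL-Probability.Probability"
begin

section \<open>The space of continuous functions on \<open>[0,1]\<close> vanishing at \<open>0\<close>\<close>

text \<open>
  A function on \<open>[0,1]\<close> is represented by its extension by \<open>0\<close> to the real line, so that every
  element of the function space has exactly one representative.
\<close>

typedef path = "{x :: real \<Rightarrow> real. continuous_on {0..1} x \<and> x 0 = 0 \<and> (\<forall>s. s \<notin> {0..1} \<longrightarrow> x s = 0)}"
  morphisms path_eval Abs_path
  by (rule exI[of _ "\<lambda>_. 0"]) auto

setup_lifting type_definition_path

lemma path_eqI: "(\<And>s. s \<in> {0..1} \<Longrightarrow> path_eval x s = path_eval y s) \<Longrightarrow> x = y"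
  by transfer (auto simp: fun_eq_iff, metis)

lemma bdd_above_path: "bdd_above ((\<lambda>s. \<bar>path_eval x s\<bar>) ` {0..1})"
  by (rule bounded_imp_bdd_above, rule compact_imp_bounded, rule compact_continuous_image)
     (transfer, auto intro!: continuous_intros)

instantiation path :: real_vector
begin

lift_definition zero_path :: path is "\<lambda>_. 0"
  by auto

lift_definition uminus_path :: "path \<Rightarrow> path" is "\<lambda>x s. - x s"
  by (auto intro!: continuous_intros)

lift_definition plus_path :: "path \<Rightarrow> path \<Rightarrow> path" is "\<lambda>x y s. x s + y s"
  by (auto intro!: continuous_intros)

lift_definition minus_path :: "path \<Rightarrow> path \<Rightarrow> path" is "\<lambda>x y s. x s - y s"
  by (auto intro!: continuous_intros)

lift_definition scaleR_path :: "real \<Rightarrow> path \<Rightarrow> path" is "\<lambda>c x s. c * x s"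
  by (auto intro!: continuous_intros)

instance
proof
  fix a b :: real and x y z :: path
  show "x + y + z = x + (y + z)" "x + y = y + x" "0 + x = x" "- x + x = 0" "x - y = x + - y"
    "a *\<^sub>R (x + y) = a *\<^sub>R x + a *\<^sub>R y" "(a + b) *\<^sub>R x = a *\<^sub>R x + b *\<^sub>R x"
    "a *\<^sub>R b *\<^sub>R x = (a * b) *\<^sub>R x" "1 *\<^sub>R x = x"
    by (transfer, simp add: algebra_simps fun_eq_iff)+
qed

end

instantiation path :: real_normed_vector
begin

definition norm_path :: "path \<Rightarrow> real"
  where "norm_path x = (SUP s\<in>{0..1}. \<bar>path_eval x s\<bar>)"

definition dist_path :: "path \<Rightarrow> path \<Rightarrow> real"
  where "dist_path x y = norm (x - y)"

definition sgn_path :: "path \<Rightarrow> path"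
  where "sgn_path x = x /\<^sub>R norm x"

definition uniformity_path :: "(path \<times> path) filter"
  where "uniformity_path = (INF e\<in>{0 <..}. principal {(x, y). dist x y < e})"

definition open_path :: "path set \<Rightarrow> bool"
  where "open_path U = (\<forall>x\<in>U. \<forall>\<^sub>F (x', y) in uniformity. x' = x \<longrightarrow> y \<in> U)"

lemma abs_path_le_norm: "s \<in> {0..1} \<Longrightarrow> \<bar>path_eval x s\<bar> \<le> norm x"
  unfolding norm_path_def by (rule cSUP_upper[OF _ bdd_above_path])

lemma norm_path_leI: "(\<And>s. s \<in> {0..1} \<Longrightarrow> \<bar>path_eval x s\<bar> \<le> b) \<Longrightarrow> norm x \<le> b"
  unfolding norm_path_def by (rule cSUP_least) auto

instance
proof
  fix a :: real and x y :: path
  show "dist x y = norm (x - y)" "sgn x = x /\<^sub>R norm x"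
    "uniformity = (INF e\<in>{0 <..}. principal {(x :: path, y). dist x y < e})"
    by (fact dist_path_def sgn_path_def uniformity_path_def)+
  show "open U = (\<forall>x\<in>U. \<forall>\<^sub>F (x', y) in uniformity. x' = x \<longrightarrow> y \<in> U)" for U :: "path set"
    by (fact open_path_def)
  show "norm x = 0 \<longleftrightarrow> x = 0"
  proof
    assume "norm x = 0"
    then have "path_eval x s = 0" if "s \<in> {0..1}" for s
      using abs_path_le_norm[OF that, of x] by simp
    then show "x = 0"
      by (intro path_eqI) (simp add: zero_path.rep_eq)
  qed (simp add: norm_path_def zero_path.rep_eq)
  show "norm (x + y) \<le> norm x + norm y"
  proof (rule norm_path_leI)
    fix s :: real assume s: "s \<in> {0..1}"
    show "\<bar>path_eval (x + y) s\<bar> \<le> norm x + norm y"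
      using abs_path_le_norm[OF s, of x] abs_path_le_norm[OF s, of y]
      by (simp add: plus_path.rep_eq)
  qed
  have le: "norm (c *\<^sub>R w) \<le> \<bar>c\<bar> * norm w" for c and w :: path
    by (rule norm_path_leI)
       (simp add: scaleR_path.rep_eq abs_mult mult_left_mono abs_path_le_norm)
  show "norm (a *\<^sub>R x) = \<bar>a\<bar> * norm x"
  proof (cases "a = 0")
    case True
    then show ?thesis
      by (simp add: norm_path_def zero_path.rep_eq)
  next
    case False
    have "inverse a *\<^sub>R a *\<^sub>R x = x"
      using False by transfer (auto simp: fun_eq_iff)
    then have "norm x \<le> \<bar>inverse a\<bar> * norm (a *\<^sub>R x)"
      using le[of "inverse a" "a *\<^sub>R x"] by simp
    then have "\<bar>a\<bar> * norm x \<le> norm (a *\<^sub>R x)"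
      using False by (simp add: field_simps)
    with le[of a x] show ?thesis by simp
  qed
qed

end


section \<open>Multivariate normal distributions\<close>

text \<open>
  Throughout, \<open>\<real>\<^sup>k\<close> with its Borel \<open>\<sigma>\<close>-field is the product space over the index set \<open>{..<k}\<close>, and
  points \<open>t\<^sub>1, \<dots>, t\<^sub>k\<close> are the values \<open>t 0, \<dots>, t (k - 1)\<close>.
\<close>

abbreviation borel_pow :: "nat \<Rightarrow> (nat \<Rightarrow> real) measure"
  where "borel_pow k \<equiv> PiM {..<k} (\<lambda>_. borel)"

text \<open>The univariate normal distribution with mean \<open>m\<close> and variance \<open>v\<close>; a point mass if \<open>v = 0\<close>.\<close>

definition normal_distr :: "real \<Rightarrow> real \<Rightarrow> real measure"
  where "normal_distr m v = (if v = 0 then return borel m else density lborel (normal_density m (sqrt v)))"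

text \<open>
  A distribution on \<open>\<real>\<^sup>k\<close> is normal if every linear combination of the coordinates has a (possibly
  degenerate) univariate normal distribution.  The mean and the variance required here say that
  \<open>m\<close> is the vector of means and \<open>S\<close> the matrix of covariances of the coordinates.
\<close>

definition is_mv_normal :: "nat \<Rightarrow> (nat \<Rightarrow> real) \<Rightarrow> (nat \<Rightarrow> nat \<Rightarrow> real) \<Rightarrow> (nat \<Rightarrow> real) measure \<Rightarrow> bool"
  where "is_mv_normal k m S N \<longleftrightarrow>
    prob_space N \<and> sets N = sets (borel_pow k) \<and>
    (\<forall>a :: nat \<Rightarrow> real.
       distr N borel (\<lambda>y. \<Sum>j<k. a j * y j) =
       normal_distr (\<Sum>j<k. a j * m j) (\<Sum>j<k. \<Sum>r<k. a j * a r * S j r))"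

definition mv_normal :: "nat \<Rightarrow> (nat \<Rightarrow> real) \<Rightarrow> (nat \<Rightarrow> nat \<Rightarrow> real) \<Rightarrow> (nat \<Rightarrow> real) measure"
  where "mv_normal k m S = (THE N. is_mv_normal k m S N)"


section \<open>The set functions \<open>\<phi>\<close> and \<open>\<mu>\<close>\<close>

definition proj :: "(nat \<Rightarrow> real) \<Rightarrow> nat \<Rightarrow> path \<Rightarrow> nat \<Rightarrow> real"
  where "proj t k x = (\<lambda>j\<in>{..<k}. path_eval x (t j))"

definition nu :: "(nat \<Rightarrow> real) \<Rightarrow> nat \<Rightarrow> (nat \<Rightarrow> real) measure"
  where "nu t k = mv_normal k (\<lambda>_. 0) (\<lambda>j r. min (t j) (t r))"

text \<open>
  The measure on the \<open>\<sigma>\<close>-field of all preimages of Borel sets \<open>B\<close> under \<open>proj t k\<close> that gives such a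
  preimage the mass \<open>nu t k B\<close>.
\<close>

definition alpha :: "(nat \<Rightarrow> real) \<Rightarrow> nat \<Rightarrow> path measure"
  where "alpha t k = extend_measure UNIV (sets (borel_pow k)) (\<lambda>B. proj t k -` B) (emeasure (nu t k))"

definition phi :: "(nat \<Rightarrow> real) \<Rightarrow> path set \<Rightarrow> ennreal"
  where "phi t K = lim (\<lambda>n. emeasure (alpha t n) (proj t n -` proj t n ` K))"

definition mu :: "(nat \<Rightarrow> real) \<Rightarrow> path set \<Rightarrow> ennreal"
  where "mu t A = (SUP K \<in> {K. K \<subseteq> A \<and> compact K}. phi t K)"

end

theory Submission
  imports Defs
begin

text \<open>
  The measure \<open>\<mu>\<close> is Wiener measure.  The Levy-Ciesielski series with independent standard normal
  coefficients converges almost surely in the separable Banach space \<open>path\<close>, and the distribution of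
  its sum is a Borel probability measure whose finite-dimensional distributions are the \<open>nu t k\<close>.
  A compact set \<open>K\<close> is the decreasing intersection of its cylinder hulls \<open>proj t n -` proj t n ` K\<close>,
  because \<open>t\<close> is dense; hence \<open>\<phi>(K)\<close> is the Wiener measure of \<open>K\<close>, and \<open>\<mu>(A)\<close> is the Wiener
  measure of \<open>A\<close> by inner regularity of finite Borel measures on Polish spaces.
\<close>


section \<open>The path space is a Polish space\<close>

text \<open>Two definitions say nothing until a witness is exhibited: \<open>mv_normal\<close> is a
  \<open>THE\<close> term, and \<open>extend_measure\<close> in \<open>alpha\<close> takes the
  prescribed values only if some measure has them. Building the path measure first settles both. Its
  projections satisfy \<open>is_mv_normal\<close>, uniqueness of such laws identifies them with
  \<open>nu t k\<close>, and the same measure is then the extension witness for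
  \<open>alpha t k\<close>. Additivity of \<mu> is inherited from this measure, not derived from
  \<phi>. The covariance is computed without Hilbert space theory. Writing min s r as s r plus the
  covariance of the Brownian bridge reduces it to a kernel which, up to one product of tents, is
  made of two half-scale copies of itself. Iteration yields the Schauder series with an explicit
  remainder of size at most 2^(-n).\<close>

lemma topological_basis_balls_of_dense:
  fixes D :: "'a::metric_space set"
  assumes "closure D = UNIV"
  shows "topological_basis ((\<lambda>(d, n). ball d (inverse (real (Suc n)))) ` (D \<times> UNIV))"
proof (rule topological_basisI)
  fix U :: "'a set" and x assume "open U" "x \<in> U"
  then obtain e where e: "e > 0" "ball x e \<subseteq> U"
    by (meson openE)
  obtain n where n: "inverse (real (Suc n)) < e / 2"
    using reals_Archimedean[of "e / 2"] e by auto
  have "x \<in> closure D"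
    using assms by simp
  then obtain d where d: "d \<in> D" "dist d x < inverse (real (Suc n))"
    unfolding closure_approachable by (metis inverse_positive_iff_positive of_nat_0_less_iff zero_less_Suc)
  have "ball d (inverse (real (Suc n))) \<subseteq> ball x e"
  proof
    fix y assume "y \<in> ball d (inverse (real (Suc n)))"
    then show "y \<in> ball x e"
      using d n dist_triangle[of x y d] by (simp add: dist_commute)
  qed
  then show "\<exists>B\<in>(\<lambda>(d, n). ball d (inverse (real (Suc n)))) ` (D \<times> UNIV). x \<in> B \<and> B \<subseteq> U"
    using d e by (intro bexI[of _ "ball d (inverse (real (Suc n)))"]) auto
qed auto

section \<open>Point evaluations and polynomial approximation of paths\<close>

lemma path_eval_simps [simp]:
  "path_eval (x + y) s = path_eval x s + path_eval y s"
  "path_eval (x - y) s = path_eval x s - path_eval y s"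
  "path_eval (c *\<^sub>R x) s = c * path_eval x s"
  "path_eval 0 s = 0"
  by (simp_all add: plus_path.rep_eq minus_path.rep_eq scaleR_path.rep_eq zero_path.rep_eq)

lemma path_eval_sum [simp]: "path_eval (sum f A) s = (\<Sum>i\<in>A. path_eval (f i) s)"
  by (induction A rule: infinite_finite_induct) auto

lemma path_eval_zero [simp]: "path_eval x 0 = 0"
  by transfer auto

lemma path_eval_outside [simp]: "s \<notin> {0..1} \<Longrightarrow> path_eval x s = 0"
  by transfer auto

lemma continuous_on_path_eval: "continuous_on {0..1} (path_eval x)"
  by transfer auto

lemma abs_path_eval_diff_le_dist: "\<bar>path_eval x s - path_eval y s\<bar> \<le> dist x y"
  using abs_path_le_norm[of s "x - y"] by (cases "s \<in> {0..1}") (auto simp: dist_norm)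

lemma continuous_on_eval_at: "continuous_on A (\<lambda>x. path_eval x s)"
proof (rule continuous_onI)
  fix x e assume "0 < (e::real)"
  then show "\<exists>d>0. \<forall>x'\<in>A. dist x' x < d \<longrightarrow> dist (path_eval x' s) (path_eval x s) \<le> e"
    by (intro exI[of _ e]) (metis abs_path_eval_diff_le_dist dist_real_def order.strict_implies_order order.trans)
qed

text \<open>The cut-off produces the representative chosen by the typedef; the result is meaningful
  when f is continuous on the unit interval and vanishes at 0.\<close>

definition path_of :: "(real \<Rightarrow> real) \<Rightarrow> path"
  where "path_of f = Abs_path (\<lambda>s. if s \<in> {0..1} then f s else 0)"

lemma path_eval_path_of:
  assumes "continuous_on {0..1} f" "f 0 = 0" "s \<in> {0..1}"
  shows "path_eval (path_of f) s = f s"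
proof -
  have "continuous_on {0..1} (\<lambda>s. if s \<in> {0..1} then f s else 0)"
    by (rule continuous_on_eq[OF assms(1)]) auto
  then show ?thesis
    unfolding path_of_def using assms by (subst Abs_path_inverse) auto
qed

text \<open>Weierstrass approximation with rational coefficients. Constants are not paths, so only
  the monomials s^(i+1) are used; dropping the constant term is harmless because the approximated
  path vanishes at 0.\<close>

lemma countable_dense_paths: "\<exists>D :: path set. countable D \<and> closure D = UNIV"
proof (intro exI conjI)
  define mono :: "nat \<Rightarrow> path" where "mono i = path_of (\<lambda>s. s ^ Suc i)" for i
  have mono: "path_eval (mono i) s = s ^ Suc i" if "s \<in> {0..1}" for i s
    unfolding mono_def using that by (intro path_eval_path_of continuous_intros) auto
  define D where "D = range (\<lambda>l::rat list. \<Sum>i<length l. of_rat (l ! i) *\<^sub>R mono i)"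
  show "countable D"
    unfolding D_def by auto
  show "closure D = UNIV"
  proof (intro equalityI subsetI)
    fix x :: path
    show "x \<in> closure D"
      unfolding closure_approachable
    proof safe
      fix e :: real assume "0 < e"
      \<comment> \<open>Error budget: e/6 for the polynomial, e/6 for its constant term, e/3 for
        rounding the n remaining coefficients. The total 2e/3 leaves room for the strict
        inequality.\<close>
      obtain g where g: "real_polynomial_function g" "\<And>s. s \<in> {0..1} \<Longrightarrow> \<bar>path_eval x s - g s\<bar> < e / 6"
        using Stone_Weierstrass_real_polynomial_function[OF _ continuous_on_path_eval, of "e / 6" x] \<open>0 < e\<close>
        by auto
      then obtain a n where a: "g = (\<lambda>s. \<Sum>i\<le>n. a i * s ^ i)"
        unfolding real_polynomial_function_iff_sum by auto
      have g_eq: "g s = a 0 + (\<Sum>i<n. a (Suc i) * s ^ Suc i)" for s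
        unfolding a lessThan_Suc_atMost[symmetric] by (subst sum.lessThan_Suc_shift) simp
      have "a 0 = g 0" unfolding g_eq by simp
      then have a0: "\<bar>a 0\<bar> < e / 6"
        using g(2)[of 0] by simp
      have "\<exists>q::rat. \<bar>of_rat q - a (Suc i)\<bar> < e / (3 * (real n + 1))" for i
      proof -
        obtain r where r: "a (Suc i) < of_rat r" "of_rat r < a (Suc i) + e / (3 * (real n + 1))"
          using of_rat_dense[of "a (Suc i)" "a (Suc i) + e / (3 * (real n + 1))"] \<open>0 < e\<close> by auto
        then show ?thesis by (intro exI[of _ r]) auto
      qed
      then obtain q :: "nat \<Rightarrow> rat" where q: "\<And>i. \<bar>of_rat (q i) - a (Suc i)\<bar> < e / (3 * (real n + 1))"
        by metis
      define y where "y = (\<Sum>i<n. of_rat (q i) *\<^sub>R mono i)"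
      have "y \<in> D"
        unfolding D_def y_def by (rule image_eqI[of _ _ "map q [0..<n]"]) auto
      moreover have "norm (y - x) \<le> 2 * e / 3"
      proof (rule norm_path_leI)
        fix s :: real assume s: "s \<in> {0..1}"
        have "path_eval y s - (\<Sum>i<n. a (Suc i) * s ^ Suc i) = (\<Sum>i<n. (of_rat (q i) - a (Suc i)) * s ^ Suc i)"
          unfolding y_def by (simp add: mono[OF s] sum_subtractf algebra_simps)
        also have "\<bar>\<dots>\<bar> \<le> (\<Sum>i<n. e / (3 * (real n + 1)))"
        proof (intro order_trans[OF sum_abs] sum_mono)
          fix i
          have "s ^ Suc i \<le> 1" "0 \<le> s ^ Suc i" using s by (auto simp del: power_Suc intro!: power_le_one)
          then have "\<bar>of_rat (q i) - a (Suc i)\<bar> * s ^ Suc i \<le> e / (3 * (real n + 1)) * 1"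
            using q[of i] by (intro mult_mono) auto
          then show "\<bar>(of_rat (q i) - a (Suc i)) * s ^ Suc i\<bar> \<le> e / (3 * (real n + 1))"
            using \<open>0 \<le> s ^ Suc i\<close> by (simp only: abs_mult abs_of_nonneg)
        qed
        also have "\<dots> \<le> e / 3"
          using \<open>0 < e\<close> by (simp add: field_simps)
        finally have "\<bar>path_eval y s - (\<Sum>i<n. a (Suc i) * s ^ Suc i)\<bar> \<le> e / 3" .
        then show "\<bar>path_eval (y - x) s\<bar> \<le> 2 * e / 3"
          using g(2)[OF s] a0 unfolding g_eq path_eval_simps by linarith
      qed
      ultimately show "\<exists>y\<in>D. dist y x < e"
        using \<open>0 < e\<close> by (intro bexI[of _ y]) (auto simp: dist_norm)
    qed
  qed auto
qed

text \<open>Second countability makes sums of random paths Borel measurable; together with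
  completeness it gives inner regularity by compact sets.\<close>

instance path :: second_countable_topology
proof
  obtain D :: "path set" where D: "countable D" "closure D = UNIV"
    using countable_dense_paths by auto
  show "\<exists>B :: path set set. countable B \<and> open = generate_topology B"
    using topological_basis_imp_subbasis[OF topological_basis_balls_of_dense[OF D(2)]] D(1)
    by (intro exI conjI) auto
qed

instance path :: banach
proof
  fix X :: "nat \<Rightarrow> path" assume X: "Cauchy X"
  have "\<forall>e>0. \<exists>N. \<forall>m n s. N \<le> m \<and> N \<le> n \<and> s \<in> {0..1} \<longrightarrow> dist (path_eval (X m) s) (path_eval (X n) s) < e"
  proof safe
    fix e :: real assume "e > 0"
    then obtain N where "\<And>m n. m \<ge> N \<Longrightarrow> n \<ge> N \<Longrightarrow> dist (X m) (X n) < e"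
      using X unfolding Cauchy_def by blast
    then show "\<exists>N. \<forall>m n s. N \<le> m \<and> N \<le> n \<and> s \<in> {0..1} \<longrightarrow> dist (path_eval (X m) s) (path_eval (X n) s) < e"
      by (metis abs_path_eval_diff_le_dist dist_real_def order.strict_trans1)
  qed
  then obtain l where l: "\<forall>e>0. \<exists>N. \<forall>n s. N \<le> n \<and> s \<in> {0..1} \<longrightarrow> dist (path_eval (X n) s) (l s) < e"
    unfolding uniformly_convergent_eq_cauchy[symmetric] by auto
  have lim: "uniform_limit {0..1} (\<lambda>n. path_eval (X n)) l sequentially"
    unfolding uniform_limit_iff eventually_sequentially using l by (metis)
  have "continuous_on {0..1} l"
    by (rule uniform_limit_theorem[OF _ lim]) (auto simp: continuous_on_path_eval)
  moreover have "l 0 = 0"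
    using tendsto_uniform_limitI[OF lim, of 0] by (simp add: LIMSEQ_const_iff)
  ultimately have eval: "path_eval (path_of l) s = l s" if "s \<in> {0..1}" for s
    using that by (rule path_eval_path_of)
  have "X \<longlonglongrightarrow> path_of l"
  proof (rule metric_LIMSEQ_I)
    fix e :: real assume "e > 0"
    \<comment> \<open>Half of e, because a strict pointwise bound passes to the supremum only as a
      weak one.\<close>
    then obtain N where N: "\<And>n s. N \<le> n \<Longrightarrow> s \<in> {0..1} \<Longrightarrow> \<bar>path_eval (X n) s - l s\<bar> < e / 2"
      using l[rule_format, of "e / 2"] by (auto simp: dist_real_def)
    have "norm (X n - path_of l) \<le> e / 2" if "N \<le> n" for n
      using N[OF that] by (intro norm_path_leI) (simp add: eval less_imp_le)
    then show "\<exists>N. \<forall>n\<ge>N. dist (X n) (path_of l) < e"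
      using \<open>e > 0\<close> by (intro exI[of _ N] allI impI) (force simp: dist_norm)
  qed
  then show "convergent X"
    by (auto simp: convergent_def)
qed


section \<open>Schauder functions\<close>

text \<open>The primitive of the unnormalised Haar wavelet: slope 1 up to the midpoint, then slope
  -1, with peak value 1/2.\<close>

definition tent :: "real \<Rightarrow> real"
  where "tent x = max 0 (min x (1 - x))"

lemma tent_eq_0: "\<not> (0 < x \<and> x < 1) \<Longrightarrow> tent x = 0"
  by (auto simp: tent_def)

lemma abs_tent_le: "\<bar>tent x\<bar> \<le> 1"
  by (auto simp: tent_def)

lemma continuous_on_tent [continuous_intros]:
  "continuous_on A f \<Longrightarrow> continuous_on A (\<lambda>x. tent (f x))"
  unfolding tent_def by (intro continuous_intros)

text \<open>The covariance of the Brownian bridge, set to 0 off the open unit square so that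
  rescaled copies for different dyadic intervals can be added without case distinctions.\<close>

definition bridge_kernel :: "real \<Rightarrow> real \<Rightarrow> real"
  where "bridge_kernel s r = (if 0 < s \<and> s < 1 \<and> 0 < r \<and> r < 1 then min s r - s * r else 0)"

lemma abs_bridge_kernel_le: "\<bar>bridge_kernel s r\<bar> \<le> 1"
proof (cases "0 < s \<and> s < 1 \<and> 0 < r \<and> r < 1")
  case True
  then have "s * r \<le> min s r" "0 \<le> s * r" "min s r \<le> 1"
    by (auto simp: mult_left_le mult_left_le_one_le)
  then show ?thesis
    unfolding bridge_kernel_def if_P[OF True] by linarith
qed (auto simp: bridge_kernel_def)

text \<open>Levy's midpoint construction at the level of covariances: interpolating the midpoint
  value, of variance 1/4, contributes the product of tents, and what remains are independent bridges
  on the two halves with half the variance.\<close>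

lemma bridge_kernel_self_similar:
  "bridge_kernel s r =
    tent s * tent r + (bridge_kernel (2 * s) (2 * r) + bridge_kernel (2 * s - 1) (2 * r - 1)) / 2"
  by (auto simp: bridge_kernel_def tent_def min_def max_def field_simps)

lemma sum_lessThan_double: "(\<Sum>k<2 * N. f k) = (\<Sum>k<N. f (2 * k) + f (2 * k + 1))"
  for f :: "nat \<Rightarrow> 'a::comm_monoid_add"
  by (induction N) (auto simp: algebra_simps)

lemma bridge_kernel_expansion:
  "bridge_kernel s r =
    (\<Sum>m<n. (1 / 2) ^ m * (\<Sum>k<2 ^ m. tent (2 ^ m * s - real k) * tent (2 ^ m * r - real k))) +
    (1 / 2) ^ n * (\<Sum>k<2 ^ n. bridge_kernel (2 ^ n * s - real k) (2 ^ n * r - real k))"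
proof (induction n)
  case (Suc n)
  \<comment> \<open>The dyadic interval k of level n has the children 2k and 2k + 1 on level n +
    1.\<close>
  have "(\<Sum>k<2 ^ n. bridge_kernel (2 ^ n * s - real k) (2 ^ n * r - real k)) =
      (\<Sum>k<2 ^ n. tent (2 ^ n * s - real k) * tent (2 ^ n * r - real k)) +
      (\<Sum>k<2 ^ n. bridge_kernel (2 ^ Suc n * s - real (2 * k)) (2 ^ Suc n * r - real (2 * k)) +
         bridge_kernel (2 ^ Suc n * s - real (2 * k + 1)) (2 ^ Suc n * r - real (2 * k + 1))) / 2"
    unfolding sum_divide_distrib sum.distrib[symmetric]
    by (intro sum.cong refl, subst bridge_kernel_self_similar) (simp add: algebra_simps)
  also have "(\<Sum>k<2 ^ n. bridge_kernel (2 ^ Suc n * s - real (2 * k)) (2 ^ Suc n * r - real (2 * k)) +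
         bridge_kernel (2 ^ Suc n * s - real (2 * k + 1)) (2 ^ Suc n * r - real (2 * k + 1))) =
      (\<Sum>k<2 ^ Suc n. bridge_kernel (2 ^ Suc n * s - real k) (2 ^ Suc n * r - real k))"
    using sum_lessThan_double[of "\<lambda>k. bridge_kernel (2 ^ Suc n * s - real k) (2 ^ Suc n * r - real k)" "2 ^ n"]
    by simp
  finally show ?case
    using Suc.IH by (simp add: distrib_left algebra_simps)
qed simp

text \<open>Unit intervals at distinct integer shifts have disjoint interiors, so at most the term
  with index \<open>nat \<lfloor>a\<rfloor>\<close> survives.\<close>

lemma abs_sum_shifts_le:
  fixes f :: "nat \<Rightarrow> real"
  assumes "\<And>k. \<not> (0 < a - real k \<and> a - real k < 1) \<Longrightarrow> f k = 0" and "\<And>k. k < N \<Longrightarrow> \<bar>f k\<bar> \<le> c" and "0 \<le> c"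
  shows "\<bar>\<Sum>k<N. f k\<bar> \<le> c"
proof -
  have eq: "k = nat \<lfloor>a\<rfloor>" if "0 < a - real k" "a - real k < 1" for k
    using that by linarith
  have "(\<Sum>k<N. f k) = (\<Sum>k<N. if nat \<lfloor>a\<rfloor> = k then f k else 0)"
    using assms(1) eq by (intro sum.cong) auto
  also have "\<dots> = (if nat \<lfloor>a\<rfloor> < N then f (nat \<lfloor>a\<rfloor>) else 0)"
    by (subst sum.delta') auto
  finally show ?thesis
    using assms(2,3) by auto
qed

text \<open>The factor 2^(-m/2) makes these the primitives of the L2-normalised Haar functions;
  \<open>line\<close> is the primitive of the constant Haar function.\<close>

definition schauder :: "nat \<Rightarrow> nat \<Rightarrow> path"
  where "schauder m k = path_of (\<lambda>s. sqrt (1 / 2) ^ m * tent (2 ^ m * s - real k))"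

definition line :: path
  where "line = path_of (\<lambda>s. s)"

lemma path_eval_line: "s \<in> {0..1} \<Longrightarrow> path_eval line s = s"
  unfolding line_def by (rule path_eval_path_of) (auto intro: continuous_intros)

lemma path_eval_schauder:
  "s \<in> {0..1} \<Longrightarrow> path_eval (schauder m k) s = sqrt (1 / 2) ^ m * tent (2 ^ m * s - real k)"
  unfolding schauder_def by (rule path_eval_path_of) (auto intro!: continuous_intros tent_eq_0)

text \<open>This is Parseval's identity for the indicators of [0,s] and [0,r] in the Haar basis,
  obtained here by telescoping. The remainder is 2^(-n) times a sum with at most one nonzero
  term.\<close>

lemma schauder_expansion_min:
  assumes s: "s \<in> {0..1}" and r: "r \<in> {0..1}"
  shows "(\<lambda>n. s * r + (\<Sum>m<n. \<Sum>k<2 ^ m. path_eval (schauder m k) s * path_eval (schauder m k) r))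
    \<longlonglongrightarrow> min s r"
proof -
  define R where "R n = (1 / 2) ^ n * (\<Sum>k<2 ^ n. bridge_kernel (2 ^ n * s - real k) (2 ^ n * r - real k))" for n
  have eq: "sqrt (1 / 2) ^ m * a * (sqrt (1 / 2) ^ m * b) = (1 / 2) ^ m * (a * b)" for m a b
    by (metis (no_types, lifting) mult.assoc mult.commute power_mult_distrib real_sqrt_mult_self abs_of_nonneg zero_le_divide_1_iff zero_le_numeral)
  have "s * r + (\<Sum>m<n. \<Sum>k<2 ^ m. path_eval (schauder m k) s * path_eval (schauder m k) r) =
      s * r + bridge_kernel s r - R n" for n
    unfolding R_def
    by (subst bridge_kernel_expansion[of s r n]) (simp add: path_eval_schauder[OF s] path_eval_schauder[OF r] sum_distrib_left eq)
  \<comment> \<open>At the endpoints the kernel is 0 by definition, and min s r = s r holds there as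
    well.\<close>
  moreover have "bridge_kernel s r = min s r - s * r"
    using s r by (auto simp: bridge_kernel_def min_def)
  moreover have "R \<longlonglongrightarrow> 0"
  proof (rule Lim_null_comparison[OF always_eventually])
    show "\<forall>n. norm (R n) \<le> (1 / 2) ^ n * 1"
    proof
      fix n
      have "\<bar>\<Sum>k<2 ^ n. bridge_kernel (2 ^ n * s - real k) (2 ^ n * r - real k)\<bar> \<le> 1"
        by (rule abs_sum_shifts_le[of "2 ^ n * s"]) (auto simp: abs_bridge_kernel_le, auto simp: bridge_kernel_def)
      then show "norm (R n) \<le> (1 / 2) ^ n * 1"
        unfolding R_def real_norm_def abs_mult by (intro mult_mono) auto
    qed
  qed (auto intro!: LIMSEQ_power_zero)
  ultimately show ?thesis
    using tendsto_diff[OF tendsto_const[of "min s r"] \<open>R \<longlonglongrightarrow> 0\<close>] by simp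
qed

text \<open>Disjoint supports within a level let the largest coefficient, not the sum of all 2^m,
  control the supremum norm.\<close>

lemma norm_sum_schauder_le:
  assumes "\<And>k. k < 2 ^ m \<Longrightarrow> \<bar>c k\<bar> \<le> b" "0 \<le> b"
  shows "norm (\<Sum>k<2 ^ m. c k *\<^sub>R schauder m k) \<le> sqrt (1 / 2) ^ m * b"
proof (rule norm_path_leI)
  fix s :: real assume s: "s \<in> {0..1}"
  have "\<bar>\<Sum>k<2 ^ m. c k * (sqrt (1 / 2) ^ m * tent (2 ^ m * s - real k))\<bar> \<le> sqrt (1 / 2) ^ m * b"
  proof (rule abs_sum_shifts_le[of "2 ^ m * s"])
    fix k :: nat assume "k < 2 ^ m"
    then have "\<bar>c k\<bar> * (sqrt (1 / 2) ^ m * \<bar>tent (2 ^ m * s - real k)\<bar>) \<le> b * (sqrt (1 / 2) ^ m * 1)"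
      using assms abs_tent_le by (intro mult_mono) auto
    then show "\<bar>c k * (sqrt (1 / 2) ^ m * tent (2 ^ m * s - real k))\<bar> \<le> sqrt (1 / 2) ^ m * b"
      by (simp add: abs_mult mult.commute)
  qed (use assms in \<open>auto intro: tent_eq_0\<close>)
  then show "\<bar>path_eval (\<Sum>k<2 ^ m. c k *\<^sub>R schauder m k) s\<bar> \<le> sqrt (1 / 2) ^ m * b"
    by (simp add: path_eval_schauder[OF s])
qed


section \<open>Uniqueness of multivariate normal distributions\<close>

lemma density_normal_eq_distr:
  assumes "0 < \<sigma>"
  shows "density lborel (normal_density 0 \<sigma>) = distr std_normal_distribution borel (\<lambda>x. \<sigma> * x)"
proof -
  interpret prob_space std_normal_distribution
    by (rule prob_space_normal_density) simp
  have "distributed std_normal_distribution lborel (\<lambda>x. x) std_normal_density"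
    by (auto simp: distributed_def distr_id2 cong: distr_cong)
  from normal_density_affine[OF this, of \<sigma> 0] assms
  have "distributed std_normal_distribution lborel (\<lambda>x. \<sigma> * x) (normal_density 0 \<sigma>)"
    by simp
  from distributed_distr_eq_density[OF this] show ?thesis
    by (simp cong: distr_cong)
qed

lemma real_distribution_normal_distr:
  assumes "0 \<le> v"
  shows "real_distribution (normal_distr m v)"
  unfolding real_distribution_def real_distribution_axioms_def normal_distr_def
  using assms by (auto intro!: prob_space_return prob_space_normal_density)

lemma char_normal_distr:
  assumes "0 \<le> v"
  shows "char (normal_distr 0 v) \<theta> = complex_of_real (exp (- (v * \<theta>\<^sup>2) / 2))"
proof (cases "v = 0")
  case True
  then show ?thesis
    by (simp add: normal_distr_def char_def integral_return)
next
  case False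
  with assms have "normal_distr 0 v = distr std_normal_distribution borel (\<lambda>x. sqrt v * x)"
    using density_normal_eq_distr[of "sqrt v"] by (simp add: normal_distr_def)
  then have "char (normal_distr 0 v) \<theta> = char std_normal_distribution (\<theta> * sqrt v)"
    by (simp add: char_def integral_distr mult.assoc)
  then show ?thesis
    using assms by (simp add: char_std_normal_distribution power_mult_distrib mult.commute)
qed

text \<open>Normalising w to a probability density turns the hypothesis into equality of the
  characteristic functions of X under the two weighted measures. Levy's theorem then equates the
  laws of X, in particular on B.\<close>

lemma weighted_char_eq_imp_integral_eq:
  fixes M1 M2 :: "'a measure" and w X :: "'a \<Rightarrow> real"
  assumes "finite_measure M1" "finite_measure M2" and sets: "sets M2 = sets M1"
    and [measurable]: "w \<in> borel_measurable M1" "X \<in> borel_measurable M1"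
    and w: "\<And>x. 0 \<le> w x" "\<And>x. w x \<le> c"
    and eq: "\<And>\<theta>. (\<integral>x. w x *\<^sub>R iexp (\<theta> * X x) \<partial>M1) = (\<integral>x. w x *\<^sub>R iexp (\<theta> * X x) \<partial>M2)"
    and B: "B \<in> sets borel"
  shows "(\<integral>x. indicator B (X x) * w x \<partial>M1) = (\<integral>x. indicator B (X x) * w x \<partial>M2)"
proof -
  have sets2[measurable_cong]: "sets M2 = sets M1" by fact
  have integrable_w: "integrable M w" "integrable M (\<lambda>x. indicator B (X x) * w x)"
    if "M = M1 \<or> M = M2" for M
  proof -
    have "finite_measure M" using that assms(1,2) by auto
    moreover have "w \<in> borel_measurable M" "(\<lambda>x. indicator B (X x) * w x) \<in> borel_measurable M"
      using that B by (auto simp: measurable_cong_sets[OF sets refl])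
    ultimately show "integrable M w" "integrable M (\<lambda>x. indicator B (X x) * w x)"
      using w order_trans[OF w(1) w(2)]
      by (auto intro!: finite_measure.integrable_const_bound[where B = c] simp: indicator_def)
  qed
  \<comment> \<open>Frequency 0 gives equal total masses, so both measures are normalised by the
    same constant.\<close>
  have "complex_of_real (\<integral>x. w x \<partial>M1) = complex_of_real (\<integral>x. w x \<partial>M2)"
    using eq[of 0] by (simp add: of_real_def[symmetric] scaleR_conv_of_real)
  then have total: "(\<integral>x. w x \<partial>M1) = (\<integral>x. w x \<partial>M2)"
    by simp
  define W where "W = (\<integral>x. w x \<partial>M1)"
  have W: "(\<integral>x. w x \<partial>M) = W" if "M = M1 \<or> M = M2" for M
    using that total by (auto simp: W_def)
  have "0 \<le> W" unfolding W_def using w(1) by (rule Bochner_Integration.integral_nonneg)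
  have bounds: "0 \<le> (\<integral>x. indicator B (X x) * w x \<partial>M)" "(\<integral>x. indicator B (X x) * w x \<partial>M) \<le> W"
    if "M = M1 \<or> M = M2" for M
    using integrable_w[OF that] w unfolding W[OF that, symmetric]
    by (auto intro!: Bochner_Integration.integral_nonneg integral_mono simp: indicator_def)
  show ?thesis
  proof (cases "W = 0")
    case True
    \<comment> \<open>A weight of mass zero cannot be normalised, but both sides lie between 0 and
      W.\<close>
    then show ?thesis using bounds[of M1] bounds[of M2] by simp
  next
    case False
    with \<open>0 \<le> W\<close> have "0 < W" by simp
    define D where "D M = distr (density M (\<lambda>x. ennreal (w x / W))) borel X" for M
    have D: "real_distribution (D M)"
      "char (D M) \<theta> = (\<integral>x. w x *\<^sub>R iexp (\<theta> * X x) \<partial>M) / W"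
      "measure (D M) B = (\<integral>x. indicator B (X x) * w x \<partial>M) / W" if M: "M = M1 \<or> M = M2" for M \<theta>
    proof -
      have [measurable]: "w \<in> borel_measurable M" "X \<in> borel_measurable M"
        using M by (auto simp: measurable_cong_sets[OF sets refl])
      have "(\<integral>\<^sup>+ x. ennreal (w x / W) \<partial>M) = ennreal (\<integral>x. w x / W \<partial>M)"
        using integrable_w[OF M] w \<open>0 < W\<close> by (intro nn_integral_eq_integral) auto
      also have "\<dots> = 1"
        using W[OF M] \<open>0 < W\<close> by simp
      finally have "prob_space (density M (\<lambda>x. ennreal (w x / W)))"
        by (intro prob_spaceI) (simp add: emeasure_density cong: nn_integral_cong)
      then interpret P: prob_space "density M (\<lambda>x. ennreal (w x / W))" .
      show D: "real_distribution (D M)"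
        unfolding D_def by (rule P.real_distribution_distr) simp
      have "char (D M) \<theta> = (\<integral>x. (w x / W) *\<^sub>R iexp (\<theta> * X x) \<partial>M)"
        unfolding D_def char_def using w \<open>0 < W\<close>
        by (subst integral_distr) (auto intro!: integral_density)
      also have "\<dots> = (\<integral>x. (w x *\<^sub>R iexp (\<theta> * X x)) / W \<partial>M)"
        by (intro Bochner_Integration.integral_cong) (auto simp: scaleR_conv_of_real)
      finally show "char (D M) \<theta> = (\<integral>x. w x *\<^sub>R iexp (\<theta> * X x) \<partial>M) / W"
        by simp
      interpret D: real_distribution "D M" by (rule D)
      have "measure (D M) B = (\<integral>x. indicator B x \<partial>D M)"
        using B by simp
      also have "\<dots> = (\<integral>x. (w x / W) *\<^sub>R indicator B (X x) \<partial>M)"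
        unfolding D_def using w \<open>0 < W\<close> B
        by (subst integral_distr, simp, simp, subst integral_density) auto
      also have "\<dots> = (\<integral>x. (indicator B (X x) * w x) / W \<partial>M)"
        by (intro Bochner_Integration.integral_cong) auto
      finally show "measure (D M) B = (\<integral>x. indicator B (X x) * w x \<partial>M) / W"
        by simp
    qed
    have "D M1 = D M2"
      by (rule Levy_uniqueness) (simp_all only: D eq fun_eq_iff simp_thms)
    then show ?thesis
      using D(3)[of M1] D(3)[of M2] \<open>0 < W\<close> by simp
  qed
qed

lemma
  shows of_real_cos_iexp: "complex_of_real (cos x) = (iexp x + iexp (- x)) / 2"
    and of_real_sin_iexp: "complex_of_real (sin x) = (iexp x - iexp (- x)) / (2 * \<i>)"
  by (simp_all flip: cos_of_real sin_of_real add: cos_exp_eq sin_exp_eq)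

text \<open>A trigonometric weight only shifts the phase by z in either direction, so weighted
  characteristic functions are combinations of unweighted ones.\<close>

lemma weight_cos_iexp:
  "(I * (1 + cos z)) *\<^sub>R iexp \<theta> =
    I *\<^sub>R iexp \<theta> + (1 / 2 * I *\<^sub>R iexp (\<theta> + z) + 1 / 2 * I *\<^sub>R iexp (\<theta> - z))"
proof -
  have "iexp (\<theta> + z) = iexp \<theta> * iexp z" "iexp (\<theta> - z) = iexp \<theta> * iexp (- z)"
    by (simp_all add: exp_add[symmetric] algebra_simps)
  then show ?thesis
    by (simp only: scaleR_conv_of_real of_real_mult of_real_add of_real_1 of_real_cos_iexp)
       (simp add: algebra_simps add_divide_distrib)
qed

lemma weight_sin_iexp:
  "(I * (1 + sin z)) *\<^sub>R iexp \<theta> =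
    I *\<^sub>R iexp \<theta> + (1 / (2 * \<i>) * I *\<^sub>R iexp (\<theta> + z) + - (1 / (2 * \<i>)) * I *\<^sub>R iexp (\<theta> - z))"
proof -
  have "iexp (\<theta> + z) = iexp \<theta> * iexp z" "iexp (\<theta> - z) = iexp \<theta> * iexp (- z)"
    by (simp_all add: exp_add[symmetric] algebra_simps)
  then show ?thesis
    by (simp only: scaleR_conv_of_real of_real_mult of_real_add of_real_1 of_real_sin_iexp)
       (simp add: algebra_simps diff_divide_distrib)
qed

text \<open>
  The coordinates are localised to Borel sets one at a time.  The nonnegative weights \<open>1 + cos\<close> and
  \<open>1 + sin\<close> of the phase in the remaining coordinates turn each step into an application of the
  one-dimensional uniqueness theorem.
\<close>

lemma mv_char_eq_imp_measure_eq:
  fixes N1 N2 :: "(nat \<Rightarrow> real) measure"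
  assumes "prob_space N1" "prob_space N2"
    and sets1: "sets N1 = sets (borel_pow k)" and sets2: "sets N2 = sets (borel_pow k)"
    and char: "\<And>a :: nat \<Rightarrow> real. (\<integral>y. iexp (\<Sum>j<k. a j * y j) \<partial>N1) = (\<integral>y. iexp (\<Sum>j<k. a j * y j) \<partial>N2)"
  shows "N1 = N2"
proof -
  interpret N1: prob_space N1 by fact
  interpret N2: prob_space N2 by fact
  have [measurable_cong]: "sets N1 = sets (borel_pow k)" "sets N2 = sets (borel_pow k)" by fact+
  define I :: "nat \<Rightarrow> (nat \<Rightarrow> real set) \<Rightarrow> (nat \<Rightarrow> real) \<Rightarrow> real"
    where "I m B y = (\<Prod>j<m. indicator (B j) (y j))" for m B y
  define L :: "nat \<Rightarrow> (nat \<Rightarrow> real) \<Rightarrow> (nat \<Rightarrow> real) \<Rightarrow> real"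
    where "L m a y = (\<Sum>j=m..<k. a j * y j)" for m a y
  have I01: "0 \<le> I m B y" "I m B y \<le> 1" for m B y
    by (auto simp: I_def intro!: prod_nonneg prod_le_1)
  have I_meas: "I m B \<in> borel_measurable (borel_pow k)" if "m \<le> k" "\<And>j. B j \<in> sets borel" for m B
  proof -
    have "(\<lambda>y. indicator (B j) (y j) :: real) \<in> borel_measurable (borel_pow k)" if "j < m" for j
    proof -
      have [measurable]: "B j \<in> sets borel" "j \<in> {..<k}"
        using \<open>m \<le> k\<close> \<open>j < m\<close> \<open>\<And>j. B j \<in> sets borel\<close> by auto
      show ?thesis by measurable
    qed
    then show ?thesis
      unfolding I_def by (intro borel_measurable_prod) auto
  qed
  have L_meas [measurable]: "L m a \<in> borel_measurable (borel_pow k)" for m a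
    unfolding L_def
    by (intro borel_measurable_sum borel_measurable_times borel_measurable_const measurable_component_singleton) auto
  \<comment> \<open>Interpolation between hypothesis and conclusion: for m = 0 this is equality of
    characteristic functions, for m = k equality on boxes.\<close>
  have E: "(\<integral>y. I m B y *\<^sub>R iexp (L m a y) \<partial>N1) = (\<integral>y. I m B y *\<^sub>R iexp (L m a y) \<partial>N2)"
    if "m \<le> k" "\<And>j. B j \<in> sets borel" for m B a
    using that
  proof (induction m arbitrary: B a)
    case 0
    then show ?case using char[of a] by (simp add: I_def L_def lessThan_atLeast0)
  next
    case (Suc m)
    have m: "m < k" "m \<le> k" using Suc.prems by auto
    have [measurable]: "(\<lambda>y. y m) \<in> borel_measurable (borel_pow k)"
      using m by (intro measurable_component_singleton) auto
    have [measurable]: "I m B \<in> borel_measurable (borel_pow k)"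
      using Suc.prems by (intro I_meas) auto
    have [measurable]: "B m \<in> sets borel" using Suc.prems by auto
    \<comment> \<open>Overwriting entry m frees the frequency of that coordinate, as the
      one-dimensional theorem requires.\<close>
    have L_split: "L m (b(m := \<theta>)) y = \<theta> * y m + L (Suc m) b y" for b \<theta> y
    proof -
      have "(\<Sum>j=Suc m..<k. (b(m := \<theta>)) j * y j) = (\<Sum>j=Suc m..<k. b j * y j)"
        by (intro sum.cong) auto
      then show ?thesis
        using m by (simp add: L_def sum.atLeast_Suc_lessThan)
    qed
    have IH: "(\<integral>y. I m B y *\<^sub>R iexp (\<theta> * y m + L (Suc m) b y) \<partial>N1) =
        (\<integral>y. I m B y *\<^sub>R iexp (\<theta> * y m + L (Suc m) b y) \<partial>N2)" for b \<theta>
      using Suc.IH[of B "b(m := \<theta>)"] m Suc.prems unfolding L_split by simp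
    let ?C = "\<lambda>y. cos (L (Suc m) a y)" and ?S = "\<lambda>y. sin (L (Suc m) a y)"
    have int: "integrable N (\<lambda>y. I m B y *\<^sub>R iexp (\<theta> * y m + L (Suc m) b y))" if "N = N1 \<or> N = N2" for N b \<theta>
    proof -
      have "finite_measure N" using that N1.finite_measure_axioms N2.finite_measure_axioms by auto
      moreover have "(\<lambda>y. I m B y *\<^sub>R iexp (\<theta> * y m + L (Suc m) b y)) \<in> borel_measurable N"
        using that by auto
      ultimately show ?thesis
        using I01 by (intro finite_measure.integrable_const_bound[where B = 1]) auto
    qed
    \<comment> \<open>The coefficient vectors -a and 0 supply the other two phases of the weighted
      exponential.\<close>
    have neg: "L (Suc m) (\<lambda>j. - a j) y = - L (Suc m) a y" "L (Suc m) (\<lambda>j. 0) y = 0" for y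
      by (simp_all add: L_def sum_negf)
    have step: "(\<integral>y. indicator (B m) (y m) * w y \<partial>N1) = (\<integral>y. indicator (B m) (y m) * w y \<partial>N2)"
      if w: "\<And>\<theta> y. w y *\<^sub>R iexp (\<theta> * y m) =
          I m B y *\<^sub>R iexp (\<theta> * y m) + (p * I m B y *\<^sub>R iexp (\<theta> * y m + L (Suc m) a y) +
          q * I m B y *\<^sub>R iexp (\<theta> * y m - L (Suc m) a y))"
        and [measurable]: "w \<in> borel_measurable (borel_pow k)" and "\<And>y. 0 \<le> w y" "\<And>y. w y \<le> 2" for w p q
    proof (rule weighted_char_eq_imp_integral_eq[where c = 2])
      fix \<theta>
      show "(\<integral>y. w y *\<^sub>R iexp (\<theta> * y m) \<partial>N1) = (\<integral>y. w y *\<^sub>R iexp (\<theta> * y m) \<partial>N2)"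
        unfolding w
        using int[of N1] int[of N2] int[of _ \<theta> "\<lambda>_. 0"] int[of _ \<theta> "\<lambda>j. - a j"]
          IH IH[of \<theta> "\<lambda>_. 0"] IH[of \<theta> "\<lambda>j. - a j"]
        by (simp add: neg del: of_real_add of_real_mult of_real_diff mult_scaleR_right)
    qed (use that in \<open>auto simp: sets1 sets2 N1.finite_measure_axioms N2.finite_measure_axioms\<close>)
    have one: "(\<integral>y. indicator (B m) (y m) * I m B y \<partial>N1) = (\<integral>y. indicator (B m) (y m) * I m B y \<partial>N2)"
      using I01 order_trans[OF I01(2), of 2] by (intro step[of _ 0 0]) auto
    have cos: "(\<integral>y. indicator (B m) (y m) * (I m B y * (1 + ?C y)) \<partial>N1) =
        (\<integral>y. indicator (B m) (y m) * (I m B y * (1 + ?C y)) \<partial>N2)"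
    proof (intro step[of _ "1 / 2" "1 / 2"])
      fix y
      show "0 \<le> I m B y * (1 + ?C y)"
        using I01[of m B y] cos_ge_minus_one[of "L (Suc m) a y"] by (intro mult_nonneg_nonneg) linarith+
      have "I m B y * (1 + ?C y) \<le> 1 * 2"
        using I01[of m B y] cos_ge_minus_one[of "L (Suc m) a y"] cos_le_one[of "L (Suc m) a y"]
        by (intro mult_mono) linarith+
      then show "I m B y * (1 + ?C y) \<le> 2" by simp
    next
      fix \<theta> y
      show "(I m B y * (1 + ?C y)) *\<^sub>R iexp (\<theta> * y m) =
          I m B y *\<^sub>R iexp (\<theta> * y m) + (1 / 2 * I m B y *\<^sub>R iexp (\<theta> * y m + L (Suc m) a y) +
          1 / 2 * I m B y *\<^sub>R iexp (\<theta> * y m - L (Suc m) a y))"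
        by (rule weight_cos_iexp)
    qed auto
    have sin: "(\<integral>y. indicator (B m) (y m) * (I m B y * (1 + ?S y)) \<partial>N1) =
        (\<integral>y. indicator (B m) (y m) * (I m B y * (1 + ?S y)) \<partial>N2)"
    proof (intro step[of _ "1 / (2 * \<i>)" "- (1 / (2 * \<i>))"])
      fix y
      show "0 \<le> I m B y * (1 + ?S y)"
        using I01[of m B y] sin_ge_minus_one[of "L (Suc m) a y"] by (intro mult_nonneg_nonneg) linarith+
      have "I m B y * (1 + ?S y) \<le> 1 * 2"
        using I01[of m B y] sin_ge_minus_one[of "L (Suc m) a y"] sin_le_one[of "L (Suc m) a y"]
        by (intro mult_mono) linarith+
      then show "I m B y * (1 + ?S y) \<le> 2" by simp
    next
      fix \<theta> y
      show "(I m B y * (1 + ?S y)) *\<^sub>R iexp (\<theta> * y m) =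
          I m B y *\<^sub>R iexp (\<theta> * y m) + (1 / (2 * \<i>) * I m B y *\<^sub>R iexp (\<theta> * y m + L (Suc m) a y) +
          - (1 / (2 * \<i>)) * I m B y *\<^sub>R iexp (\<theta> * y m - L (Suc m) a y))"
        by (rule weight_sin_iexp)
    qed auto
    \<comment> \<open>Subtracting the unweighted integral removes the 1 that was added to keep the
      weights nonnegative; real and imaginary parts then recombine by Euler's formula.\<close>
    have split: "(\<integral>y. I (Suc m) B y *\<^sub>R iexp (L (Suc m) a y) \<partial>N) =
        complex_of_real ((\<integral>y. indicator (B m) (y m) * (I m B y * (1 + ?C y)) \<partial>N) - (\<integral>y. indicator (B m) (y m) * I m B y \<partial>N)) +
        \<i> * complex_of_real ((\<integral>y. indicator (B m) (y m) * (I m B y * (1 + ?S y)) \<partial>N) - (\<integral>y. indicator (B m) (y m) * I m B y \<partial>N))"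
      if "N = N1 \<or> N = N2" for N
    proof -
      have fin: "finite_measure N" using that N1.finite_measure_axioms N2.finite_measure_axioms by auto
      have meas: "(\<lambda>y. indicator (B m) (y m) * I m B y * ?C y) \<in> borel_measurable N"
        "(\<lambda>y. indicator (B m) (y m) * I m B y * ?S y) \<in> borel_measurable N"
        "(\<lambda>y. indicator (B m) (y m) * I m B y) \<in> borel_measurable N"
        using that by auto
      have "\<bar>indicator (B m) (y m) * I m B y * z\<bar> \<le> 1" if "\<bar>z\<bar> \<le> 1" for y z
        using I01[of m B y] that by (auto simp: indicator_def abs_mult intro!: mult_le_one)
      from this[of 1] this[of "cos _"] this[of "sin _"]
      have int: "integrable N (\<lambda>y. indicator (B m) (y m) * I m B y * ?C y)"
        "integrable N (\<lambda>y. indicator (B m) (y m) * I m B y * ?S y)"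
        "integrable N (\<lambda>y. indicator (B m) (y m) * I m B y)"
        by (auto intro!: finite_measure.integrable_const_bound[OF fin _ meas(1), where B = 1]
          finite_measure.integrable_const_bound[OF fin _ meas(2), where B = 1]
          finite_measure.integrable_const_bound[OF fin _ meas(3), where B = 1])
      have "I (Suc m) B y *\<^sub>R iexp (L (Suc m) a y) =
          complex_of_real (indicator (B m) (y m) * I m B y * ?C y) +
          \<i> * complex_of_real (indicator (B m) (y m) * I m B y * ?S y)" for y
        by (simp add: I_def scaleR_conv_of_real exp_Euler cos_of_real sin_of_real algebra_simps)
      then have "(\<integral>y. I (Suc m) B y *\<^sub>R iexp (L (Suc m) a y) \<partial>N) =
          complex_of_real (\<integral>y. indicator (B m) (y m) * I m B y * ?C y \<partial>N) +
          \<i> * complex_of_real (\<integral>y. indicator (B m) (y m) * I m B y * ?S y \<partial>N)"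
        using int by (simp del: of_real_mult)
      then show ?thesis
        using int by (simp add: distrib_left mult.assoc[symmetric] del: of_real_mult)
    qed
    show ?case
      using split[of N1] split[of N2] one cos sin by simp
  qed
  show ?thesis
  proof (rule measure_eqI_PiM_finite)
    fix A :: "nat \<Rightarrow> real set" assume "\<And>i. i \<in> {..<k} \<Longrightarrow> A i \<in> sets borel"
    \<comment> \<open>The empty set is only a Borel default: \<open>I k\<close> reads indices below
      k.\<close>
    then have A: "(if i < k then A i else {}) \<in> sets borel" for i by auto
    have P: "complex_of_real (measure N (Pi\<^sub>E {..<k} A)) =
        (\<integral>y. I k (\<lambda>i. if i < k then A i else {}) y *\<^sub>R iexp (L k (\<lambda>_. 0) y) \<partial>N)"
      if sets: "sets N = sets (borel_pow k)" for N
    proof -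
      have "I k (\<lambda>i. if i < k then A i else {}) y = indicator (Pi\<^sub>E {..<k} A) y" if "y \<in> space N" for y
      proof -
        have "y \<in> extensional {..<k}"
          using that sets_eq_imp_space_eq[OF sets] by (auto simp: space_PiM PiE_def)
        then show ?thesis
          by (auto simp: I_def indicator_def PiE_iff intro!: prod.neutral)
      qed
      then have "(\<integral>y. I k (\<lambda>i. if i < k then A i else {}) y *\<^sub>R iexp (L k (\<lambda>_. 0) y) \<partial>N) =
          (\<integral>y. complex_of_real (indicator (Pi\<^sub>E {..<k} A) y) \<partial>N)"
        by (intro Bochner_Integration.integral_cong) (auto simp: L_def scaleR_conv_of_real)
      then show ?thesis
        using sets.sets_into_space[of "Pi\<^sub>E {..<k} A" N] \<open>\<And>i. i \<in> {..<k} \<Longrightarrow> A i \<in> sets borel\<close>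
        by (auto simp: sets intro!: sets_PiM_I_finite simp: Int_absorb2)
    qed
    have "complex_of_real (measure N1 (Pi\<^sub>E {..<k} A)) = complex_of_real (measure N2 (Pi\<^sub>E {..<k} A))"
      unfolding P[OF sets1] P[OF sets2] by (rule E) (auto simp: A)
    then show "N1 (Pi\<^sub>E {..<k} A) = N2 (Pi\<^sub>E {..<k} A)"
      by (simp add: N1.emeasure_eq_measure N2.emeasure_eq_measure)
  next
    show "range (\<lambda>_::nat. Pi\<^sub>E {..<k} (\<lambda>_. UNIV)) \<subseteq> prod_algebra {..<k} (\<lambda>_. borel :: real measure)"
      by (auto intro!: prod_algebraI_finite)
  qed (auto simp: sets1 sets2 space_PiM)
qed

text \<open>The Cramer-Wold device: the joint characteristic function at a is that of the linear
  combination with coefficients a, taken at frequency 1.\<close>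

lemma integral_iexp_mv_normal:
  assumes "is_mv_normal k m S N"
  shows "(\<integral>y. iexp (\<Sum>j<k. a j * y j) \<partial>N) =
    char (normal_distr (\<Sum>j<k. a j * m j) (\<Sum>j<k. \<Sum>r<k. a j * a r * S j r)) 1"
proof -
  have [measurable_cong]: "sets N = sets (borel_pow k)"
    using assms by (simp add: is_mv_normal_def)
  have "(\<lambda>y. \<Sum>j<k. a j * y j) \<in> borel_measurable (borel_pow k)"
    by (intro borel_measurable_sum borel_measurable_times borel_measurable_const measurable_component_singleton) auto
  then have "char (distr N borel (\<lambda>y. \<Sum>j<k. a j * y j)) 1 = (\<integral>y. iexp (\<Sum>j<k. a j * y j) \<partial>N)"
    unfolding char_def by (subst integral_distr) auto
  then show ?thesis
    using assms by (simp add: is_mv_normal_def)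
qed

text \<open>Mean and covariance fix the joint characteristic function and hence the law, so the
  description in \<open>mv_normal\<close> is unique once a witness exists.\<close>

lemma mv_normal_eqI:
  assumes "is_mv_normal k m S N"
  shows "mv_normal k m S = N"
  unfolding mv_normal_def
proof (rule the_equality)
  fix N' assume "is_mv_normal k m S N'"
  then show "N' = N"
    using assms integral_iexp_mv_normal[OF assms] integral_iexp_mv_normal[of k m S N']
    by (intro mv_char_eq_imp_measure_eq[of _ _ k]) (auto simp: is_mv_normal_def simp del: of_real_sum)
qed fact


section \<open>Wiener measure\<close>

definition gauss_seq :: "(nat \<times> nat \<Rightarrow> real) measure"
  where "gauss_seq = PiM UNIV (\<lambda>_. std_normal_distribution)"

interpretation gauss_prod: product_prob_space "\<lambda>_. std_normal_distribution" "UNIV :: (nat \<times> nat) set"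
  by (intro product_prob_spaceI prob_space_normal_density) simp

interpretation gauss_seq: prob_space gauss_seq
  unfolding gauss_seq_def by (rule gauss_prod.prob_space_axioms)

lemma sets_gauss_seq [measurable_cong]: "sets gauss_seq = sets (PiM UNIV (\<lambda>_. borel))"
  unfolding gauss_seq_def by (intro sets_PiM_cong) auto

lemma space_gauss_seq [simp]: "space gauss_seq = UNIV"
  by (simp add: gauss_seq_def space_PiM)

lemma distr_gauss_seq_component: "distr gauss_seq borel (\<lambda>\<omega>. \<omega> i) = std_normal_distribution"
  using gauss_prod.PiM_component[of i] by (simp add: gauss_seq_def cong: distr_cong)

lemma indep_vars_gauss_seq: "gauss_seq.indep_vars (\<lambda>_. borel) (\<lambda>i \<omega>. \<omega> i) UNIV"
proof (subst gauss_seq.indep_vars_iff_distr_eq_PiM)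
  have "distr gauss_seq (PiM UNIV (\<lambda>_. borel)) (\<lambda>\<omega>. \<omega>) = gauss_seq"
    by (rule distr_id2) (rule sets_gauss_seq[symmetric])
  then show "distr gauss_seq (PiM UNIV (\<lambda>_. borel)) (\<lambda>\<omega>. \<lambda>i\<in>UNIV. \<omega> i) =
      (\<Pi>\<^sub>M i\<in>UNIV. distr gauss_seq borel (\<lambda>\<omega>. \<omega> i))"
    by (simp add: distr_gauss_seq_component restrict_UNIV) (simp add: gauss_seq_def)
qed auto

lemma char_sum_gauss_seq:
  fixes c :: "nat \<times> nat \<Rightarrow> real"
  assumes "finite I"
  shows "char (distr gauss_seq borel (\<lambda>\<omega>. \<Sum>i\<in>I. c i * \<omega> i)) \<theta> =
    complex_of_real (exp (- ((\<Sum>i\<in>I. (c i)\<^sup>2) * \<theta>\<^sup>2) / 2))"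
proof -
  have "gauss_seq.indep_vars (\<lambda>_. borel) (\<lambda>i \<omega>. c i * \<omega> i) I"
    by (rule gauss_seq.indep_vars_compose2[OF gauss_seq.indep_vars_subset[OF indep_vars_gauss_seq]]) auto
  moreover have "char (distr gauss_seq borel (\<lambda>\<omega>. c i * \<omega> i)) \<theta> =
      complex_of_real (exp (- ((c i)\<^sup>2 * \<theta>\<^sup>2) / 2))" for i
  proof -
    have "char (distr gauss_seq borel (\<lambda>\<omega>. c i * \<omega> i)) \<theta> =
        char (distr gauss_seq borel (\<lambda>\<omega>. \<omega> i)) (\<theta> * c i)"
      by (simp add: char_def integral_distr mult.assoc)
    then show ?thesis
      by (simp add: distr_gauss_seq_component char_std_normal_distribution power_mult_distrib mult.commute)
  qed
  ultimately show ?thesis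
    by (simp add: gauss_seq.char_distr_sum exp_sum[OF assms, symmetric] sum_negf sum_distrib_right sum_divide_distrib
        flip: of_real_prod)
qed

lemma nn_integral_gauss_seq_power4: "(\<integral>\<^sup>+\<omega>. ennreal ((\<omega> i) ^ 4) \<partial>gauss_seq) = 3"
proof -
  have "(\<integral>\<^sup>+\<omega>. ennreal ((\<omega> i) ^ 4) \<partial>gauss_seq) = (\<integral>\<^sup>+x. ennreal (x ^ 4) \<partial>distr gauss_seq borel (\<lambda>\<omega>. \<omega> i))"
    by (subst nn_integral_distr) auto
  also have "\<dots> = ennreal (\<integral>x. x ^ 4 \<partial>std_normal_distribution)"
    unfolding distr_gauss_seq_component using std_normal_distribution_even_moments(2)[of 2]
    by (intro nn_integral_eq_integral) auto
  \<comment> \<open>The moment of order 2j is (2j)! / (2^j j!), here with j = 2.\<close>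
  also have "(\<integral>x. x ^ 4 \<partial>std_normal_distribution) = 3"
    using std_normal_distribution_even_moments(1)[of 2] by (simp add: fact_numeral)
  finally show ?thesis by simp
qed

definition schauder_level :: "nat \<Rightarrow> (nat \<times> nat \<Rightarrow> real) \<Rightarrow> path"
  where "schauder_level m \<omega> = (\<Sum>k<2 ^ m. \<omega> (m, k) *\<^sub>R schauder m k)"

text \<open>
  The coordinate \<open>(0, 1)\<close> is not used by any level, since level \<open>0\<close> has only the tent with \<open>k = 0\<close>;
  it serves as the coefficient of the linear path.
\<close>

definition wiener_path :: "(nat \<times> nat \<Rightarrow> real) \<Rightarrow> path"
  where "wiener_path \<omega> = \<omega> (0, 1) *\<^sub>R line + (\<Sum>m. schauder_level m \<omega>)"

definition wiener :: "path measure"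
  where "wiener = distr gauss_seq borel wiener_path"

lemma borel_measurable_schauder_level [measurable]: "schauder_level m \<in> borel_measurable gauss_seq"
  unfolding schauder_level_def[abs_def] by measurable

text \<open>\<open>suminf\<close> of Borel maps is Borel on the whole space, including the null set
  where the series diverges.\<close>

lemma borel_measurable_wiener_path [measurable]: "wiener_path \<in> borel_measurable gauss_seq"
  unfolding wiener_path_def[abs_def] by measurable

lemma prob_space_wiener: "prob_space wiener"
  unfolding wiener_def by (rule gauss_seq.prob_space_distr) simp

lemma sets_wiener [simp, measurable_cong]: "sets wiener = sets borel"
  by (simp add: wiener_def)

lemma space_wiener [simp]: "space wiener = UNIV"
  by (simp add: wiener_def)

text \<open>
  The coefficients on level \<open>m\<close> are almost surely \<open>O((6/5)^m)\<close>, because \<open>2 < (6/5)^4\<close> makes the sum of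
  the fourth moments of the \<open>2^m\<close> coefficients, divided by \<open>(6/5)^(4 m)\<close>, summable over \<open>m\<close>; and
  \<open>6/5 < sqrt 2\<close> keeps the series of the level norms summable.
\<close>

lemma AE_summable_schauder_level: "AE \<omega> in gauss_seq. summable (\<lambda>m. schauder_level m \<omega>)"
proof -
  define q :: real where "q = (6 / 5) ^ 4"
  have q: "2 < q" by (simp add: q_def power_divide)
  define g where "g m \<omega> = (\<Sum>k<2 ^ m. (\<omega> (m, k)) ^ 4) / q ^ m" for m :: nat and \<omega> :: "nat \<times> nat \<Rightarrow> real"
  have g_nonneg: "0 \<le> g m \<omega>" for m \<omega>
    unfolding g_def using q by (intro divide_nonneg_nonneg sum_nonneg) auto
  have [measurable]: "g m \<in> borel_measurable gauss_seq" for m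
    unfolding g_def by measurable
  have "(\<integral>\<^sup>+\<omega>. ennreal (g m \<omega>) \<partial>gauss_seq) = ennreal (3 * (2 / q) ^ m)" for m
  proof -
    have "ennreal (g m \<omega>) = ennreal (1 / q ^ m) * (\<Sum>k<2 ^ m. ennreal ((\<omega> (m, k)) ^ 4))" for \<omega>
      unfolding g_def using q by (subst sum_ennreal) (auto simp: ennreal_mult'[symmetric])
    then have "(\<integral>\<^sup>+\<omega>. ennreal (g m \<omega>) \<partial>gauss_seq) = ennreal (1 / q ^ m) * (\<Sum>k<(2::nat) ^ m. 3)"
      by (simp add: nn_integral_cmult nn_integral_sum nn_integral_gauss_seq_power4 del: sum_ennreal)
    also have "(\<Sum>k<(2::nat) ^ m. 3) = ennreal (2 ^ m * 3)"
      by (simp add: ennreal_mult ennreal_power[symmetric])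
    also have "ennreal (1 / q ^ m) * ennreal (2 ^ m * 3) = ennreal (1 / q ^ m * (2 ^ m * 3))"
      using q by (intro ennreal_mult[symmetric]) auto
    also have "1 / q ^ m * (2 ^ m * 3) = 3 * (2 / q) ^ m"
      by (simp add: power_divide)
    finally show ?thesis .
  qed
  then have "(\<integral>\<^sup>+\<omega>. (\<Sum>m. ennreal (g m \<omega>)) \<partial>gauss_seq) = (\<Sum>m. ennreal (3 * (2 / q) ^ m))"
    by (subst nn_integral_suminf) auto
  also have "\<dots> \<noteq> \<infinity>"
    unfolding infinity_ennreal_def
    by (intro ennreal_suminf_neq_top summable_mult summable_geometric) (use q in auto)
  finally have "AE \<omega> in gauss_seq. (\<Sum>m. ennreal (g m \<omega>)) \<noteq> \<infinity>"
    by (intro nn_integral_PInf_AE) auto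
  then show ?thesis
  proof eventually_elim
    fix \<omega> assume "(\<Sum>m. ennreal (g m \<omega>)) \<noteq> \<infinity>"
    then have summable_g: "summable (\<lambda>m. g m \<omega>)"
      by (intro summable_suminf_not_top g_nonneg) simp
    \<comment> \<open>The added 1 ensures that C is at most C^4, which turns the bound into a fourth
      power and makes the root trivial.\<close>
    define C where "C = (\<Sum>m. g m \<omega>) + 1"
    have "0 \<le> (\<Sum>m. g m \<omega>)"
      by (intro suminf_nonneg summable_g g_nonneg)
    then have "1 \<le> C" by (simp add: C_def)
    have coeff: "\<bar>\<omega> (m, k)\<bar> \<le> C * (6 / 5) ^ m" if "k < 2 ^ m" for m k
    proof (rule power_le_imp_le_base)
      have "g m \<omega> \<le> C"
        using sum_le_suminf[OF summable_g, of "{m}"] g_nonneg by (simp add: C_def)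
      then have "(\<Sum>k<2 ^ m. (\<omega> (m, k)) ^ 4) \<le> C * q ^ m"
        using q by (simp add: g_def divide_le_eq)
      moreover have "(\<omega> (m, k)) ^ 4 \<le> (\<Sum>k<2 ^ m. (\<omega> (m, k)) ^ 4)"
        using that by (intro member_le_sum) auto
      moreover have "C * q ^ m \<le> C ^ 4 * q ^ m"
        using \<open>1 \<le> C\<close> self_le_power[of C 4] q by (intro mult_right_mono) auto
      moreover have "C ^ 4 * q ^ m = (C * (6 / 5) ^ m) ^ 4"
        by (simp only: q_def power_mult_distrib power_mult[symmetric] mult.commute)
      ultimately show "\<bar>\<omega> (m, k)\<bar> ^ Suc 3 \<le> (C * (6 / 5) ^ m) ^ Suc 3"
        by (simp add: power_even_abs)
    qed (use \<open>1 \<le> C\<close> in simp)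
    have bound: "norm (schauder_level m \<omega>) \<le> C * (sqrt (1 / 2) * (6 / 5)) ^ m" for m
    proof -
      have "norm (schauder_level m \<omega>) \<le> sqrt (1 / 2) ^ m * (C * (6 / 5) ^ m)"
        unfolding schauder_level_def using coeff \<open>1 \<le> C\<close> by (intro norm_sum_schauder_le) auto
      then show ?thesis
        by (simp only: power_mult_distrib mult_ac)
    qed
    have "summable (\<lambda>m. C * (sqrt (1 / 2) * (6 / 5)) ^ m)"
    proof (intro summable_mult summable_geometric)
      have "sqrt (1 / 2) < 5 / 6"
        by (rule real_less_lsqrt) (auto simp: power2_eq_square)
      moreover have "0 \<le> sqrt (1 / 2)" by simp
      ultimately show "norm (sqrt (1 / 2) * (6 / 5)) < 1"
        unfolding real_norm_def by linarith
    qed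
    then show "summable (\<lambda>m. schauder_level m \<omega>)"
      by (rule summable_comparison_test'[where N = 0]) (rule bound)
  qed
qed

text \<open>Since \<open>iexp\<close> has modulus 1, dominated convergence carries the
  characteristic functions to the limit. The limiting variance may be 0, which
  \<open>normal_distr\<close> covers by a point mass.\<close>

lemma AE_limit_normal_distr:
  fixes X :: "nat \<Rightarrow> 'a \<Rightarrow> real"
  assumes "prob_space M" and [measurable]: "\<And>n. X n \<in> borel_measurable M" "Y \<in> borel_measurable M"
    and lim: "AE x in M. (\<lambda>n. X n x) \<longlonglongrightarrow> Y x"
    and char: "\<And>n \<theta>. char (distr M borel (X n)) \<theta> = complex_of_real (exp (- (v n * \<theta>\<^sup>2) / 2))"
    and v: "v \<longlonglongrightarrow> u" "\<And>n. 0 \<le> v n"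
  shows "distr M borel Y = normal_distr 0 u"
proof -
  interpret prob_space M by fact
  have "0 \<le> u"
    using v by (intro LIMSEQ_le_const[OF v(1)]) auto
  show ?thesis
  proof (rule Levy_uniqueness)
    show "char (distr M borel Y) = char (normal_distr 0 u)"
    proof
      fix \<theta>
      have "(\<lambda>n. \<integral>x. iexp (\<theta> * X n x) \<partial>M) \<longlonglongrightarrow> (\<integral>x. iexp (\<theta> * Y x) \<partial>M)"
      proof (rule integral_dominated_convergence[where w = "\<lambda>_. 1"])
        show "AE x in M. (\<lambda>n. iexp (\<theta> * X n x)) \<longlonglongrightarrow> iexp (\<theta> * Y x)"
          using lim by eventually_elim (intro tendsto_intros)
      qed auto
      then have "(\<lambda>n. char (distr M borel (X n)) \<theta>) \<longlonglongrightarrow> char (distr M borel Y) \<theta>"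
        by (simp add: char_def integral_distr)
      moreover have "(\<lambda>n. char (distr M borel (X n)) \<theta>) \<longlonglongrightarrow> complex_of_real (exp (- (u * \<theta>\<^sup>2) / 2))"
        unfolding char by (intro tendsto_intros v) auto
      ultimately show "char (distr M borel Y) \<theta> = char (normal_distr 0 u) \<theta>"
        using LIMSEQ_unique by (simp add: char_normal_distr \<open>0 \<le> u\<close>)
    qed
  qed (use \<open>0 \<le> u\<close> in \<open>auto intro: real_distribution_normal_distr\<close>)
qed

lemma borel_measurable_path_eval [measurable]: "(\<lambda>x. path_eval x s) \<in> borel_measurable borel"
  by (rule borel_measurable_continuous_onI) (rule continuous_on_eval_at)

text \<open>Partial sums give finite combinations of independent normal variables, whose variances
  are quadratic forms in a. The expansion of min identifies the limit of these forms.\<close>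

lemma distr_wiener_linear_combination:
  fixes a t :: "nat \<Rightarrow> real"
  assumes t: "\<And>j. j < k \<Longrightarrow> t j \<in> {0..1}"
  shows "distr wiener borel (\<lambda>x. \<Sum>j<k. a j * path_eval x (t j)) =
    normal_distr 0 (\<Sum>j<k. \<Sum>r<k. a j * a r * min (t j) (t r))"
proof -
  define e :: "nat \<times> nat \<Rightarrow> path" where "e = (\<lambda>(m, k). if (m, k) = (0, 1) then line else schauder m k)"
  \<comment> \<open>The inserted index lies outside every level, so the sum over \<open>I n\<close>
    splits cleanly into the linear term and the first n levels.\<close>
  define I :: "nat \<Rightarrow> (nat \<times> nat) set" where "I n = insert (0, 1) (SIGMA m:{..<n}. {..<2 ^ m})" for n
  have fin: "finite (I n)" for n by (simp add: I_def)
  have sum_I: "(\<Sum>i\<in>I n. f i) = f (0, 1) + (\<Sum>m<n. \<Sum>k<2 ^ m. f (m, k))" for n and f :: "nat \<times> nat \<Rightarrow> 'b::comm_monoid_add"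
    unfolding I_def by (subst sum.insert) (auto simp: sum.Sigma)
  have e_simps: "e (0, 1) = line" "e (0, Suc 0) = line" "k < 2 ^ m \<Longrightarrow> e (m, k) = schauder m k" for m k
    by (auto simp: e_def)
  define c where "c i = (\<Sum>j<k. a j * path_eval (e i) (t j))" for i
  have partial: "(\<Sum>i\<in>I n. \<omega> i *\<^sub>R e i) = \<omega> (0, 1) *\<^sub>R line + (\<Sum>m<n. schauder_level m \<omega>)" for n \<omega>
    unfolding sum_I by (simp add: e_simps schauder_level_def)
  have X: "(\<Sum>i\<in>I n. c i * \<omega> i) = (\<Sum>j<k. a j * path_eval (\<Sum>i\<in>I n. \<omega> i *\<^sub>R e i) (t j))" for n \<omega>
  proof -
    have "(\<Sum>i\<in>I n. c i * \<omega> i) = (\<Sum>i\<in>I n. \<Sum>j<k. a j * (\<omega> i * path_eval (e i) (t j)))"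
      by (simp add: c_def sum_distrib_left sum_distrib_right mult_ac)
    also have "\<dots> = (\<Sum>j<k. a j * path_eval (\<Sum>i\<in>I n. \<omega> i *\<^sub>R e i) (t j))"
      by (subst sum.swap) (simp add: sum_distrib_left)
    finally show ?thesis .
  qed
  have "distr gauss_seq borel (\<lambda>\<omega>. \<Sum>j<k. a j * path_eval (wiener_path \<omega>) (t j)) =
      normal_distr 0 (\<Sum>j<k. \<Sum>r<k. a j * a r * min (t j) (t r))"
  proof (rule AE_limit_normal_distr)
    show "char (distr gauss_seq borel (\<lambda>\<omega>. \<Sum>i\<in>I n. c i * \<omega> i)) \<theta> =
        complex_of_real (exp (- ((\<Sum>i\<in>I n. (c i)\<^sup>2) * \<theta>\<^sup>2) / 2))" for n \<theta>
      by (rule char_sum_gauss_seq) (rule fin)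
    show "AE \<omega> in gauss_seq. (\<lambda>n. \<Sum>i\<in>I n. c i * \<omega> i) \<longlonglongrightarrow> (\<Sum>j<k. a j * path_eval (wiener_path \<omega>) (t j))"
      using AE_summable_schauder_level
    proof eventually_elim
      fix \<omega> assume "summable (\<lambda>m. schauder_level m \<omega>)"
      then have "(\<lambda>n. \<Sum>m<n. schauder_level m \<omega>) \<longlonglongrightarrow> (\<Sum>m. schauder_level m \<omega>)"
        by (rule summable_LIMSEQ)
      then have "(\<lambda>n. \<Sum>i\<in>I n. \<omega> i *\<^sub>R e i) \<longlonglongrightarrow> wiener_path \<omega>"
        unfolding partial wiener_path_def by (intro tendsto_intros)
      then have "(\<lambda>n. path_eval (\<Sum>i\<in>I n. \<omega> i *\<^sub>R e i) s) \<longlonglongrightarrow> path_eval (wiener_path \<omega>) s" for s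
        by (rule continuous_on_tendsto_compose[OF continuous_on_eval_at[of UNIV]]) auto
      then show "(\<lambda>n. \<Sum>i\<in>I n. c i * \<omega> i) \<longlonglongrightarrow> (\<Sum>j<k. a j * path_eval (wiener_path \<omega>) (t j))"
        unfolding X by (intro tendsto_intros)
    qed
    have "(\<Sum>i\<in>I n. (c i)\<^sup>2) =
        (\<Sum>j<k. \<Sum>r<k. a j * a r * (\<Sum>i\<in>I n. path_eval (e i) (t j) * path_eval (e i) (t r)))" for n
    proof -
      have "(\<Sum>i\<in>I n. (c i)\<^sup>2) =
          (\<Sum>i\<in>I n. \<Sum>j<k. \<Sum>r<k. a j * a r * (path_eval (e i) (t j) * path_eval (e i) (t r)))"
        unfolding c_def power2_eq_square sum_product by (simp add: mult_ac)
      also have "\<dots> = (\<Sum>j<k. \<Sum>r<k. \<Sum>i\<in>I n. a j * a r * (path_eval (e i) (t j) * path_eval (e i) (t r)))"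
        by (subst sum.swap) (intro sum.cong refl sum.swap)
      finally show ?thesis by (simp add: sum_distrib_left)
    qed
    moreover have "(\<lambda>n. \<Sum>i\<in>I n. path_eval (e i) (t j) * path_eval (e i) (t r)) \<longlonglongrightarrow> min (t j) (t r)"
      if "j < k" "r < k" for j r
      using schauder_expansion_min[OF t[OF that(1)] t[OF that(2)]] t that
      unfolding sum_I by (simp add: e_simps path_eval_line)
    ultimately show "(\<lambda>n. \<Sum>i\<in>I n. (c i)\<^sup>2) \<longlonglongrightarrow> (\<Sum>j<k. \<Sum>r<k. a j * a r * min (t j) (t r))"
      by (auto intro!: tendsto_intros)
  qed (auto intro: gauss_seq.prob_space_axioms sum_nonneg)
  then show ?thesis
    unfolding wiener_def by (subst distr_distr) (auto simp: comp_def)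
qed


section \<open>Identification of \<open>\<phi>\<close> and \<open>\<mu>\<close>\<close>

lemma proj_measurable [measurable]: "proj t k \<in> borel \<rightarrow>\<^sub>M borel_pow k"
  unfolding proj_def[abs_def] by (intro measurable_restrict borel_measurable_path_eval)

lemma nu_eq_distr_wiener:
  assumes t: "range t \<subseteq> {0..1}"
  shows "nu t k = distr wiener (borel_pow k) (proj t k)"
  unfolding nu_def
proof (rule mv_normal_eqI)
  have "(\<lambda>y. \<Sum>j<k. a j * y j) \<in> borel_measurable (borel_pow k)" for a :: "nat \<Rightarrow> real"
    by (intro borel_measurable_sum borel_measurable_times borel_measurable_const measurable_component_singleton) auto
  moreover have "(\<lambda>y. \<Sum>j<k. a j * y j) \<circ> proj t k = (\<lambda>x. \<Sum>j<k. a j * path_eval x (t j))" for a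
    by (auto simp: proj_def intro!: sum.cong)
  ultimately show "is_mv_normal k (\<lambda>_. 0) (\<lambda>j r. min (t j) (t r)) (distr wiener (borel_pow k) (proj t k))"
    using t unfolding is_mv_normal_def
    by (auto simp: distr_distr distr_wiener_linear_combination image_subset_iff
        intro!: prob_space.prob_space_distr prob_space_wiener)
qed

text \<open>\<open>wiener\<close>, restricted to the cylinders over k points, is the measure whose
  existence \<open>extend_measure\<close> presupposes. It also shows that the mass depends on the
  cylinder alone and not on the base set describing it.\<close>

lemma emeasure_alpha:
  assumes t: "range t \<subseteq> {0..1}" and B: "B \<in> sets (borel_pow k)"
  shows "emeasure (alpha t k) (proj t k -` B) = emeasure wiener (proj t k -` B)"
proof -
  have vimage: "proj t k -` C \<in> sets borel" if "C \<in> sets (borel_pow k)" for C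
    using measurable_sets[OF proj_measurable that, of t] by simp
  have nu: "emeasure wiener (proj t k -` C) = emeasure (nu t k) C" if "C \<in> sets (borel_pow k)" for C
    using that by (simp add: nu_eq_distr_wiener[OF t] emeasure_distr)
  have "sets (alpha t k) = sigma_sets UNIV ((\<lambda>C. proj t k -` C) ` sets (borel_pow k))"
    unfolding alpha_def by (rule sets_extend_measure) simp
  also have "\<dots> \<subseteq> sets wiener"
    using vimage sets.sigma_sets_subset[of _ "borel :: path measure"] by (simp add: image_subset_iff)
  finally have sub: "sets (alpha t k) \<subseteq> sets wiener" .
  then have "countably_additive (sets (alpha t k)) (emeasure wiener)"
    using emeasure_countably_additive[of wiener] unfolding countably_additive_def by blast
  moreover have "positive (sets (alpha t k)) (emeasure wiener)"
    by (simp add: positive_def)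
  ultimately have "emeasure (alpha t k) (proj t k -` B) = emeasure (nu t k) B"
    by (intro emeasure_extend_measure[OF alpha_def, where \<mu>' = "emeasure wiener"] nu B) auto
  then show ?thesis
    using nu[OF B] by simp
qed

text \<open>The image is compact, hence closed, in the space of all functions on the naturals,
  whereas measurability is claimed in the finite product; the inclusion map transfers it.\<close>

lemma proj_image_compact_measurable:
  assumes "compact K"
  shows "proj t n ` K \<in> sets (borel_pow n)"
proof -
  have "continuous_on K (proj t n)"
  proof (rule continuous_on_coordinatewise_then_product)
    show "continuous_on K (\<lambda>x. proj t n x i)" for i
      by (cases "i < n") (auto simp: proj_def continuous_on_eval_at)
  qed
  then have "closed (proj t n ` K)"
    using assms by (intro compact_imp_closed compact_continuous_image)
  then have "proj t n ` K \<in> sets (PiM UNIV (\<lambda>_::nat. borel :: real measure))"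
    by (simp add: sets_PiM_equal_borel)
  moreover have "(\<lambda>y. y) \<in> borel_pow n \<rightarrow>\<^sub>M PiM UNIV (\<lambda>_::nat. borel :: real measure)"
  proof (rule measurable_PiM_single')
    fix i :: nat
    show "(\<lambda>y. y i) \<in> borel_measurable (borel_pow n)"
    proof (cases "i < n")
      case False
      \<comment> \<open>Points of the finite product are extensional, so every coordinate beyond the
        range is constant.\<close>
      then have "y i = undefined" if "y \<in> space (borel_pow n)" for y
        using that by (auto simp: space_PiM PiE_def extensional_def)
      then show ?thesis
        by (subst measurable_cong[where g = "\<lambda>_. undefined"]) auto
    qed (auto intro: measurable_component_singleton)
  qed auto
  moreover have "proj t n ` K \<subseteq> space (borel_pow n)"
    using measurable_space[OF proj_measurable] by fastforce
  ultimately show ?thesis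
    using measurable_sets[of "\<lambda>y. y" "borel_pow n" _ "proj t n ` K"] by (auto simp: Int_absorb2)
qed

section \<open>Compact sets as intersections of their cylinder hulls\<close>

lemma path_eq_on_dense:
  assumes "{0..1} \<subseteq> closure T" "T \<subseteq> {0..1}" "\<And>s. s \<in> T \<Longrightarrow> path_eval x s = path_eval y s"
  shows "x = y"
proof (rule path_eqI)
  fix s :: real assume s: "s \<in> {0..1}"
  have "closed {s \<in> {0..1}. path_eval x s - path_eval y s = 0}"
    by (intro continuous_closed_preimage_constant continuous_on_diff continuous_on_path_eval) simp
  then have "closure T \<subseteq> {s \<in> {0..1}. path_eval x s - path_eval y s = 0}"
    using assms(2,3) by (intro closure_minimal) auto
  with s assms(1) show "path_eval x s = path_eval y s" by auto
qed

text \<open>A point x of all hulls agrees with some element y n of K at the first n points. A limit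
  l of a subsequence lies in K and agrees with x at every \<open>t j\<close>, hence
  everywhere.\<close>

lemma Inter_proj_vimage_image_compact:
  assumes "compact K" "{0..1} \<subseteq> closure (range t)" "range t \<subseteq> {0..1}"
  shows "(\<Inter>n. proj t n -` proj t n ` K) = K"
proof (intro equalityI subsetI)
  fix x assume "x \<in> (\<Inter>n. proj t n -` proj t n ` K)"
  then have "\<forall>n. \<exists>y\<in>K. proj t n x = proj t n y" by auto
  then obtain y where y: "\<And>n. y n \<in> K" "\<And>n. proj t n x = proj t n (y n)" by metis
  obtain l r where l: "l \<in> K" "strict_mono (r :: nat \<Rightarrow> nat)" "(y \<circ> r) \<longlonglongrightarrow> l"
    using assms(1) y(1) unfolding compact_def by metis
  have "path_eval l (t j) = path_eval x (t j)" for j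
  proof -
    have "(\<lambda>n. path_eval ((y \<circ> r) n) (t j)) \<longlonglongrightarrow> path_eval l (t j)"
      using l(3) by (rule continuous_on_tendsto_compose[OF continuous_on_eval_at[of UNIV]]) auto
    moreover have "path_eval ((y \<circ> r) n) (t j) = path_eval x (t j)" if "n > j" for n
    proof -
      \<comment> \<open>A strictly increasing r satisfies n \<le> r n, so \<open>y (r n)\<close>
        already matches x at \<open>t j\<close>.\<close>
      have "j < r n" using that seq_suble[OF l(2), of n] by simp
      then show ?thesis using fun_cong[OF y(2)[of "r n"], of j] by (simp add: proj_def)
    qed
    then have "\<forall>\<^sub>F n in sequentially. path_eval ((y \<circ> r) n) (t j) = path_eval x (t j)"
      unfolding eventually_sequentially by (metis Suc_le_lessD)
    then have "(\<lambda>n. path_eval ((y \<circ> r) n) (t j)) \<longlonglongrightarrow> path_eval x (t j)"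
      by (rule tendsto_eventually)
    ultimately show ?thesis by (rule LIMSEQ_unique)
  qed
  then have "l = x"
    using assms(2,3) by (intro path_eq_on_dense[of "range t"]) auto
  with l(1) show "x \<in> K" by simp
qed auto

lemma phi_compact:
  assumes K: "compact K" and dense: "{0..1} \<subseteq> closure (range t)" and t: "range t \<subseteq> {0..1}"
  shows "phi t K = emeasure wiener K"
proof -
  interpret prob_space wiener by (rule prob_space_wiener)
  let ?A = "\<lambda>n. proj t n -` proj t n ` K"
  have "range ?A \<subseteq> sets wiener"
    using measurable_sets[OF proj_measurable proj_image_compact_measurable[OF K]] by auto
  moreover have "decseq ?A"
  proof (rule decseq_SucI, rule subsetI)
    fix n x assume "x \<in> ?A (Suc n)"
    then obtain y where y: "y \<in> K" "proj t (Suc n) x = proj t (Suc n) y" by auto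
    have "proj t n x = proj t n y"
    proof
      fix j
      show "proj t n x j = proj t n y j"
        using fun_cong[OF y(2), of j] by (simp add: proj_def restrict_def split: if_splits)
    qed
    with y(1) show "x \<in> ?A n" by auto
  qed
  ultimately have "(\<lambda>n. emeasure wiener (?A n)) \<longlonglongrightarrow> emeasure wiener (\<Inter>n. ?A n)"
    by (rule Lim_emeasure_decseq) simp
  then show ?thesis
    unfolding phi_def Inter_proj_vimage_image_compact[OF K dense t]
    by (simp add: emeasure_alpha[OF t proj_image_compact_measurable[OF K]] limI)
qed

theorem theorem2p4:
  fixes t :: "nat \<Rightarrow> real"
  assumes "inj t" and "range t \<subseteq> {0<..1}" and "{0..1} \<subseteq> closure (range t)"
  shows "measure_space UNIV (sets (borel :: path measure)) (mu t) \<and> mu t UNIV = 1"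
proof -
  interpret prob_space wiener by (rule prob_space_wiener)
  have t: "range t \<subseteq> {0..1}"
    using assms(2) by (meson greaterThanAtMost_subseteq_atLeastAtMost_iff order.refl order_trans)
  have mu: "mu t A = emeasure wiener A" if "A \<in> sets borel" for A
  proof -
    \<comment> \<open>Only compact K enter the supremum, and on these \<phi> is known.\<close>
    have "mu t A = (SUP K\<in>{K. K \<subseteq> A \<and> compact K}. emeasure wiener K)"
      unfolding mu_def by (intro SUP_cong refl phi_compact assms(3) t) auto
    also have "\<dots> = emeasure wiener A"
      using that by (intro inner_regular[symmetric]) auto
    finally show ?thesis .
  qed
  \<comment> \<open>Agreement with \<open>wiener\<close> is available on Borel sets, which is where
    the measure axioms are required.\<close>
  have "countably_additive (sets borel) (mu t)"
  proof (rule countably_additiveI)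
    fix A :: "nat \<Rightarrow> path set"
    assume A: "range A \<subseteq> sets borel" "disjoint_family A" "(\<Union>i. A i) \<in> sets borel"
    then have "(\<Sum>i. mu t (A i)) = (\<Sum>i. emeasure wiener (A i))"
      by (intro suminf_cong mu) auto
    also have "\<dots> = mu t (\<Union>i. A i)"
      using A by (subst mu, simp, subst suminf_emeasure) auto
    finally show "(\<Sum>i. mu t (A i)) = mu t (\<Union>i. A i)" .
  qed
  moreover have "positive (sets borel) (mu t)"
    by (simp add: positive_def mu)
  moreover have "sigma_algebra UNIV (sets (borel :: path measure))"
    using sets.sigma_algebra_axioms[of "borel :: path measure"] by simp
  ultimately show ?thesis
    using emeasure_space_1 by (simp add: measure_space_def mu)
qed

end
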